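(* Let $0<x<1$ be real. The inverted graded parafermionic partition function of order $5$ satisfies $\frac{1}{\Delta_5(x)}=\sum_{n\ge0}a(n)x^n$, where $a(n)$ is the number of partitions of $n$ into distinct parts none of which is a multiple of $5$.
   Context: The graded parafermionic partition function of order $s$ is $\Delta_s(x)=\prod_{k\ge1}\sum_{i=0}^{s-1}(-1)^i x^{ik}$; in particular $\Delta_5(x)=\prod_{k\ge1}(1-x^k+x^{2k}-x^{3k}+x^{4k})$. In the physical setting $x=e^{-\beta\omega}$ with $\beta,\omega>0$. The empty partition is the unique partition of $0$. *)

theory Defs
  imports Complex_Main "HOL-Library.Multiset" "HOL-Analysis.Infinite_Products"
begin

definition graded_factor :: "nat \<Rightarrow> real \<Rightarrow> nat \<Rightarrow> real" where
  "graded_factor s x k = (\<Sum>i<s. (-1) ^ i * x ^ (i * k))"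

(* The product over k >= 1 is written with Suc k, as prodinf ranges over all naturals. *)
definition graded_partition_fun :: "nat \<Rightarrow> real \<Rightarrow> real" where
  "graded_partition_fun s x = prodinf (\<lambda>k. graded_factor s x (Suc k))"

definition partitions :: "nat \<Rightarrow> nat multiset set" where
  "partitions n = {P. (\<forall>p \<in># P. p \<ge> 1) \<and> sum_mset P = n}"

definition distinct_parts :: "nat multiset \<Rightarrow> bool" where
  "distinct_parts P \<longleftrightarrow> (\<forall>p. count P p \<le> 1)"

definition num_distinct_non5_partitions :: "nat \<Rightarrow> nat" where
  "num_distinct_non5_partitions n =
     card {P \<in> partitions n. distinct_parts P \<and> (\<forall>p \<in># P. \<not> 5 dvd p)}"

end

theory Submission imports Defs begin

text \<open>
  A factor of \<open>\<Delta>\<^sub>5\<close> is a finite geometric sum, \<open>(1 + x\<^sup>5\<^sup>k) / (1 + x\<^sup>k)\<close>. The numerators cancel the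
  denominators whose index is a multiple of 5, so \<open>1 / \<Delta>\<^sub>5\<close> is the product of \<open>1 + x\<^sup>k\<close> over
  the \<open>k\<close> not divisible by 5, the generating function of partitions into distinct such parts.
\<close>

text \<open>A partition into distinct parts is encoded by its set of parts. Finiteness is demanded
  because a sum over an infinite set defaults to 0, so infinite subsets of \<open>A\<close> would be
  counted at \<open>n = 0\<close>.\<close>

definition subsets_with_sum :: "nat set \<Rightarrow> nat \<Rightarrow> nat set set" where
  "subsets_with_sum A n = {S. finite S \<and> S \<subseteq> A \<and> \<Sum>S = n}"

lemma subsets_with_sum_bounded:
  assumes "0 \<notin> A" "S \<in> subsets_with_sum A n"
  shows "S \<subseteq> {1..n}"
proof
  fix k assume k: "k \<in> S"
  with assms have "k \<le> \<Sum>S" "k \<noteq> 0"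
    by (auto simp: subsets_with_sum_def intro!: member_le_sum[of k S "\<lambda>k. k"] gr0I)
  with assms show "k \<in> {1..n}"
    by (simp add: subsets_with_sum_def)
qed

lemma finite_subsets_with_sum: "0 \<notin> A \<Longrightarrow> finite (subsets_with_sum A n)"
  by (rule finite_subset[of _ "Pow {1..n}"]) (use subsets_with_sum_bounded in blast, simp)

text \<open>With all multiplicities at most 1, a multiset is determined by its support, and
  \<open>mset_set\<close> recovers it.\<close>

lemma bij_betw_distinct_partitions_subsets_with_sum:
  assumes "0 \<notin> A"
  shows "bij_betw set_mset {P \<in> partitions n. distinct_parts P \<and> set_mset P \<subseteq> A}
           (subsets_with_sum A n)"
proof (rule bij_betwI[where g = mset_set])
  have inverse: "mset_set (set_mset P) = P" if "distinct_parts P" for P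
  proof (rule multiset_eqI)
    fix k
    have "count P k \<le> 1"
      using that by (simp add: distinct_parts_def)
    then show "count (mset_set (set_mset P)) k = count P k"
      by (cases "count P k = 0") (simp_all add: not_in_iff flip: count_greater_zero_iff)
  qed
  then show "mset_set (set_mset P) = P"
    if "P \<in> {P \<in> partitions n. distinct_parts P \<and> set_mset P \<subseteq> A}" for P
    using that by blast
  have "\<Sum>(set_mset P) = sum_mset P" if "distinct_parts P" for P
    using inverse[OF that] sum_unfold_sum_mset[of "\<lambda>k. k" "set_mset P"] by simp
  then show "set_mset \<in> {P \<in> partitions n. distinct_parts P \<and> set_mset P \<subseteq> A} \<rightarrow> subsets_with_sum A n"
    by (auto simp: subsets_with_sum_def partitions_def)
  show "mset_set \<in> subsets_with_sum A n \<rightarrow> {P \<in> partitions n. distinct_parts P \<and> set_mset P \<subseteq> A}"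
  proof
    fix S assume S: "S \<in> subsets_with_sum A n"
    then have "k \<ge> 1" if "k \<in> S" for k
      using assms that subsets_with_sum_bounded by fastforce
    with S show "mset_set S \<in> {P \<in> partitions n. distinct_parts P \<and> set_mset P \<subseteq> A}"
      using sum_unfold_sum_mset[of "\<lambda>k. k" S]
      by (auto simp: subsets_with_sum_def partitions_def distinct_parts_def count_mset_set')
  qed
  show "set_mset (mset_set S) = S" if "S \<in> subsets_with_sum A n" for S
    using that by (simp add: subsets_with_sum_def)
qed

text \<open>Expanding the product picks \<open>x ^ k\<close> or 1 from each factor; \<open>S\<close>
  collects the indices where \<open>x ^ k\<close> is picked.\<close>

lemma prod_one_plus_power_eq_sum_Pow:
  fixes x :: real
  assumes "finite B"
  shows "(\<Prod>k\<in>B. 1 + x ^ k) = (\<Sum>S\<in>Pow B. x ^ \<Sum>S)"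
  using prod_add[OF assms, of "\<lambda>k. x ^ k" "\<lambda>_. 1"] by (simp add: power_sum add.commute)

lemma sum_card_subsets_with_sum:
  fixes x :: real
  assumes "0 \<notin> A"
  shows "(\<Sum>n<N. card (subsets_with_sum A n) * x ^ n) =
         (\<Sum>S\<in>(\<Union>n<N. subsets_with_sum A n). x ^ \<Sum>S)"
proof -
  have "(\<Sum>S\<in>(\<Union>n<N. subsets_with_sum A n). x ^ \<Sum>S) =
        (\<Sum>n<N. \<Sum>S\<in>subsets_with_sum A n. x ^ \<Sum>S)"
    using finite_subsets_with_sum[OF assms]
    by (intro sum.UNION_disjoint) (auto simp: subsets_with_sum_def)
  also have "\<dots> = (\<Sum>n<N. \<Sum>S\<in>subsets_with_sum A n. x ^ n)"
    by (intro sum.cong) (auto simp: subsets_with_sum_def)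
  finally show ?thesis by simp
qed

text \<open>Partial sums and partial products both add the nonnegative terms
  \<open>x ^ \<Sum>S\<close> over finite families of sets. Each family of one kind lies inside one
  of the other kind, so the two limits agree.\<close>

lemma sums_card_subsets_with_sum:
  fixes x :: real
  assumes "0 \<notin> A" "0 \<le> x"
    and lim: "(\<lambda>N. \<Prod>k\<in>A \<inter> {1..N}. 1 + x ^ k) \<longlonglongrightarrow> R"
  shows "(\<lambda>n. card (subsets_with_sum A n) * x ^ n) sums R"
proof -
  define a where "a n = card (subsets_with_sum A n) * x ^ n" for n
  define p where "p N = (\<Prod>k\<in>A \<inter> {1..N}. 1 + x ^ k)" for N
  have a_nonneg: "a n \<ge> 0" for n
    using assms by (simp add: a_def)
  have fin: "finite (\<Union>n<N. subsets_with_sum A n)" for N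
    using finite_subsets_with_sum[OF assms(1)] by simp
  have sum_le_p: "(\<Sum>n<N. a n) \<le> p N" for N
  proof -
    \<comment> \<open>A set with sum below \<open>N\<close> has no element above
      \<open>N\<close>.\<close>
    have "(\<Union>n<N. subsets_with_sum A n) \<subseteq> Pow (A \<inter> {1..N})"
      using subsets_with_sum_bounded[OF assms(1)] by (fastforce simp: subsets_with_sum_def)
    then have "(\<Sum>S\<in>(\<Union>n<N. subsets_with_sum A n). x ^ \<Sum>S) \<le> (\<Sum>S\<in>Pow (A \<inter> {1..N}). x ^ \<Sum>S)"
      using assms by (intro sum_mono2) simp_all
    then show ?thesis
      unfolding a_def p_def sum_card_subsets_with_sum[OF assms(1)]
      by (simp add: prod_one_plus_power_eq_sum_Pow)
  qed
  have p_le_sum: "\<exists>M. p N \<le> (\<Sum>n<M. a n)" for N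
  proof -
    \<comment> \<open>No subset of \<open>{1..N}\<close> exceeds the sum of the whole interval,
      whence the cut-off.\<close>
    have "Pow (A \<inter> {1..N}) \<subseteq> (\<Union>n<Suc (\<Sum>{1..N}). subsets_with_sum A n)"
    proof
      fix S assume S: "S \<in> Pow (A \<inter> {1..N})"
      then have "\<Sum>S \<le> \<Sum>{1..N}" by (intro sum_mono2) auto
      moreover have "finite S"
        using S finite_subset[of S "{1..N}"] by auto
      ultimately show "S \<in> (\<Union>n<Suc (\<Sum>{1..N}). subsets_with_sum A n)"
        using S by (auto simp: subsets_with_sum_def)
    qed
    then have "(\<Sum>S\<in>Pow (A \<inter> {1..N}). x ^ \<Sum>S) \<le>
               (\<Sum>S\<in>(\<Union>n<Suc (\<Sum>{1..N}). subsets_with_sum A n). x ^ \<Sum>S)"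
      using assms by (intro sum_mono2 fin) simp_all
    then have "p N \<le> (\<Sum>n<Suc (\<Sum>{1..N}). a n)"
      unfolding a_def p_def sum_card_subsets_with_sum[OF assms(1)]
      by (subst prod_one_plus_power_eq_sum_Pow) simp_all
    then show ?thesis ..
  qed
  \<comment> \<open>Every factor is at least 1, so the partial products increase to
    \<open>R\<close>, which then bounds the partial sums of \<open>a\<close> as well.\<close>
  have "incseq p"
    unfolding p_def using assms by (intro incseq_SucI prod_mono2) auto
  then have p_le: "p N \<le> R" for N
    using lim incseq_le unfolding p_def by blast
  have summable: "summable a"
    using sum_le_p p_le by (intro summableI_nonneg_bounded[of a R] a_nonneg) (rule order_trans)
  have "suminf a \<le> R"
    using sum_le_p p_le by (intro suminf_le_const[OF summable]) (rule order_trans)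
  moreover have "p N \<le> suminf a" for N
    using p_le_sum[of N] sum_le_suminf[OF summable] a_nonneg by (meson finite_lessThan order_trans)
  then have "R \<le> suminf a"
    unfolding p_def by (intro LIMSEQ_le_const2[OF lim]) auto
  ultimately show ?thesis
    using summable_sums[OF summable] by (simp add: a_def[abs_def])
qed

text \<open>The deviations from 1 form a geometric series of ratio \<open>x ^ c\<close>, so
  convergence is absolute. The cases \<open>c = 1\<close> and \<open>c = 5\<close> serve the
  denominators and numerators of the factors.\<close>

lemma convergent_prod_one_plus_power:
  fixes x :: real
  assumes "0 \<le> x" "x < 1" "0 < c"
  shows "convergent_prod (\<lambda>k. 1 + x ^ (c * Suc k))"
proof -
  have "x ^ c < 1"
    using assms power_less_one_iff by blast
  then have "summable (\<lambda>k. (x ^ c) ^ Suc k)"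
    using assms by (subst summable_Suc_iff) (simp add: summable_geometric)
  then have "summable (\<lambda>k. norm (1 + x ^ (c * Suc k) - 1))"
    using assms by (simp only: power_mult add_diff_cancel_left' norm_power) simp
  then show ?thesis
    by (intro abs_convergent_prod_imp_convergent_prod summable_imp_abs_convergent_prod)
qed

text \<open>The exponent \<open>1 * k\<close> gives numerator and denominator the common shape
  \<open>1 + x ^ (c * k)\<close>.\<close>

lemma graded_factor_5:
  assumes "0 < x"
  shows "graded_factor 5 x k = (1 + x ^ (5 * k)) / (1 + x ^ (1 * k))"
proof -
  define y where "y = x ^ k"
  have "y > 0" using assms by (simp add: y_def)
  have "graded_factor 5 x k = (\<Sum>i<5. (-1) ^ i * y ^ i)"
    by (simp add: graded_factor_def y_def mult.commute flip: power_mult)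
  also have "\<dots> = (1 + y ^ 5) / (1 + y)"
    using \<open>y > 0\<close>
    by (simp add: eq_divide_eq lessThan_nat_numeral lessThan_Suc algebra_simps eval_nat_numeral)
  finally show ?thesis
    by (simp add: y_def mult.commute flip: power_mult)
qed

text \<open>Cutting off at \<open>c * N\<close> makes the multiples of \<open>c\<close> in range
  exactly \<open>c * k\<close> for \<open>k\<close> from 1 to \<open>N\<close>, so the later
  cancellation is exact.\<close>

lemma prod_split_multiples:
  fixes f :: "nat \<Rightarrow> 'a::comm_monoid_mult"
  assumes "0 < c"
  shows "(\<Prod>k=1..c * N. f k) = (\<Prod>k\<in>{k. \<not> c dvd k} \<inter> {1..c * N}. f k) * (\<Prod>k=1..N. f (c * k))"
proof -
  have "(\<Prod>k=1..N. f (c * k)) = (\<Prod>k\<in>{k. c dvd k} \<inter> {1..c * N}. f k)"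
    using assms by (intro prod.reindex_bij_witness[of _ "\<lambda>k. k div c" "\<lambda>k. c * k"])
      (auto elim!: dvdE)
  moreover have "{1..c * N} = ({k. \<not> c dvd k} \<inter> {1..c * N}) \<union> ({k. c dvd k} \<inter> {1..c * N})"
    by auto
  ultimately show ?thesis
    by (subst (1) \<open>{1..c * N} = _\<close>, subst prod.union_disjoint) auto
qed

theorem mainTheorem4:
  fixes x :: real
  assumes "0 < x" and "x < 1"
  shows "convergent_prod (\<lambda>k. graded_factor 5 x (Suc k)) \<and>
         (\<lambda>n. real (num_distinct_non5_partitions n) * x ^ n) sums
           (1 / graded_partition_fun 5 x)"
proof
  define p where "p c k = 1 + x ^ (c * Suc k)" for c k
  define A :: "nat set" where "A = {k. \<not> 5 dvd k}"
  define r where "r N = (\<Prod>k\<in>A \<inter> {1..N}. 1 + x ^ k)" for N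
  have factor: "graded_factor 5 x (Suc k) = p 5 k / p 1 k" for k
    using graded_factor_5[OF assms(1)] by (simp only: p_def)
  have conv: "convergent_prod (p c)" if "0 < c" for c
    unfolding p_def using assms that by (intro convergent_prod_one_plus_power) auto
  show "convergent_prod (\<lambda>k. graded_factor 5 x (Suc k))"
    unfolding factor by (intro convergent_prod_divide conv) auto
  have "p c k > 0" for c k
    using assms by (simp add: p_def add_pos_pos)
  \<comment> \<open>A convergent infinite product vanishes only if one of its factors does.\<close>
  then have nz: "prodinf (p c) \<noteq> 0" if "0 < c" for c
    by (metis prodinf_nonzero[OF conv[OF that]] less_irrefl)
  have delta: "graded_partition_fun 5 x = prodinf (p 5) / prodinf (p 1)"
    unfolding graded_partition_fun_def factor
    by (intro has_prod_unique[symmetric] has_prod_divide convergent_prod_has_prod conv) auto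
  have lim: "(\<lambda>N. \<Prod>k=1..N. 1 + x ^ (c * k)) \<longlonglongrightarrow> prodinf (p c)" if "0 < c" for c
  proof -
    have "(\<Prod>k=1..N. 1 + x ^ (c * k)) = (\<Prod>k<N. p c k)" for N
      unfolding p_def by (rule prod.reindex_bij_witness[of _ Suc "\<lambda>k. k - 1"]) auto
    then show ?thesis
      using convergent_prod_LIMSEQ[OF conv[OF that]] by (simp add: LIMSEQ_lessThan_iff_atMost)
  qed
  \<comment> \<open>The numerator runs to \<open>5 * N\<close> but the denominator only to
    \<open>N\<close>: the denominator then cancels precisely the multiples of 5, leaving
    \<open>r (5 * N)\<close>.\<close>
  have "(\<lambda>N. (\<Prod>k=1..5 * N. 1 + x ^ (1 * k)) / (\<Prod>k=1..N. 1 + x ^ (5 * k)))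
          \<longlonglongrightarrow> prodinf (p 1) / prodinf (p 5)"
    using LIMSEQ_subseq_LIMSEQ[OF lim[of 1], of "\<lambda>N. 5 * N"] lim[of 5] nz
    by (intro tendsto_divide) (auto simp: o_def strict_mono_def)
  moreover have "(\<Prod>k=1..5 * N. 1 + x ^ (1 * k)) / (\<Prod>k=1..N. 1 + x ^ (5 * k)) = r (5 * N)" for N
  proof -
    have "(\<Prod>k=1..N. 1 + x ^ (5 * k)) > 0"
      using assms by (intro prod_pos) (simp add: add_pos_pos)
    then have "(\<Prod>k=1..N. 1 + x ^ (5 * k)) \<noteq> 0"
      by (rule less_imp_neq[symmetric])
    then show ?thesis
      unfolding r_def A_def mult_1 prod_split_multiples[OF zero_less_numeral]
      by (rule nonzero_mult_div_cancel_right)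
  qed
  ultimately have sub: "(\<lambda>N. r (5 * N)) \<longlonglongrightarrow> 1 / graded_partition_fun 5 x"
    by (simp add: delta)
  \<comment> \<open>So far only the subsequence \<open>r (5 * N)\<close> is known to converge.
    Monotonicity bounds all of \<open>r\<close> by its limit, so \<open>r\<close> converges, and the
    subsequence identifies the limit.\<close>
  have inc: "incseq r"
    unfolding r_def using assms by (intro incseq_SucI prod_mono2) auto
  have r_le: "r N \<le> 1 / graded_partition_fun 5 x" for N
  proof -
    have "r N \<le> r (5 * N)" using inc by (simp add: incseqD)
    also have "\<dots> \<le> 1 / graded_partition_fun 5 x"
      by (rule incseq_le[OF _ sub]) (use inc in \<open>auto simp: incseq_def\<close>)
    finally show ?thesis .
  qed
  then obtain L where L: "r \<longlonglongrightarrow> L"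
    using incseq_convergent[OF inc] by blast
  then have "(\<lambda>N. r (5 * N)) \<longlonglongrightarrow> L"
    using LIMSEQ_subseq_LIMSEQ[OF L, of "\<lambda>N. 5 * N"] by (auto simp: o_def strict_mono_def)
  with sub L have "r \<longlonglongrightarrow> 1 / graded_partition_fun 5 x"
    using LIMSEQ_unique by blast
  \<comment> \<open>The condition \<open>0 \<notin> A\<close> holds because 5 divides 0.\<close>
  then have "(\<lambda>n. card (subsets_with_sum A n) * x ^ n) sums (1 / graded_partition_fun 5 x)"
    using assms by (intro sums_card_subsets_with_sum) (auto simp: A_def r_def[abs_def])
  moreover have "num_distinct_non5_partitions n = card (subsets_with_sum A n)" for n
    using bij_betw_same_card[OF bij_betw_distinct_partitions_subsets_with_sum[of A n]]
    by (simp add: num_distinct_non5_partitions_def A_def subset_eq)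
  ultimately show "(\<lambda>n. real (num_distinct_non5_partitions n) * x ^ n) sums
           (1 / graded_partition_fun 5 x)"
    by simp
qed

end
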